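(* Let $k\ge 1$ be an integer and let $G$ be a $k$-uniform hypergraph with $n$ vertices and $m$ edges. Define $f:\{k-1,k,\ldots,n\}\to\mathbb{Q}$ by $$f(i)=\frac{\binom{n}{i+1}}{\binom{n}{i-k+1}}=\frac{(n-i)(n-i+1)\cdots(n-i+k-1)}{(i+1)\,i\,(i-1)\cdots(i-k+2)}$$ for every $i\in\{k-1,\ldots,n\}$, and let $$\ell(G)=\min\{\,i\in\{k-1,\ldots,n\}\;:\; f(i)\le m\,\}.$$ Then $\ell(G)\le\alpha(G)$.
   Context: A $k$-uniform hypergraph $G$ consists of a finite vertex set $V(G)$ and a set $E(G)$ of $k$-element subsets of $V(G)$ (the edges). An independent set of $G$ is a subset $S\subseteq V(G)$ that contains no edge of $G$. The independence number $\alpha(G)$ is the largest cardinality of an independent set of $G$. *)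

theory Defs
  imports Complex_Main
begin

locale uniform_hypergraph =
  fixes k :: nat and V :: "'a set" and E :: "'a set set"
  assumes finite_vertices: "finite V"
    and edge_subset: "e \<in> E \<Longrightarrow> e \<subseteq> V"
    and edge_card: "e \<in> E \<Longrightarrow> card e = k"

definition independent_set :: "'a set \<Rightarrow> 'a set set \<Rightarrow> 'a set \<Rightarrow> bool" where
  "independent_set V E S \<longleftrightarrow> S \<subseteq> V \<and> (\<forall>e\<in>E. \<not> e \<subseteq> S)"

definition independence_number :: "'a set \<Rightarrow> 'a set set \<Rightarrow> nat" where
  "independence_number V E = Max (card ` {S. independent_set V E S})"

text \<open>The function \<open>f\<close> is only meant for \<open>k \<ge> 1\<close> and \<open>i \<in> {k - 1..n}\<close>; there \<open>i + 1 - k\<close>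
  involves no truncation and the denominator is nonzero.\<close>

definition binomial_ratio :: "nat \<Rightarrow> nat \<Rightarrow> nat \<Rightarrow> rat" where
  "binomial_ratio k n i = of_nat (n choose (i + 1)) / of_nat (n choose (i + 1 - k))"

text \<open>The minimum is taken over a nonempty set as soon as \<open>k - 1 \<le> card V\<close>, since \<open>f\<close> vanishes
  at \<open>i = card V\<close>.\<close>

definition ell :: "nat \<Rightarrow> 'a set \<Rightarrow> 'a set set \<Rightarrow> nat" where
  "ell k V E = Min {i \<in> {k - 1..card V}. binomial_ratio k (card V) i \<le> of_nat (card E)}"

lemma binomial_ratio_eq_prod:
  assumes "k \<ge> 1" "i \<in> {k - 1..n}"
  shows "binomial_ratio k n i =
    (\<Prod>j<k. of_nat (n - i + j)) / (\<Prod>j<k. of_nat (i + 1 - j))"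
proof -
  have step: "of_nat (n choose (i + 1)) * (\<Prod>j<r. of_nat (i + 1 - j)) =
      (of_nat (n choose (i + 1 - r)) :: rat) * (\<Prod>j<r. of_nat (n - i + j))" if "r \<le> i + 1" for r
    using that
  proof (induction r)
    case 0
    then show ?case by simp
  next
    case (Suc r)
    let ?s = "i - r"
    have r: "r \<le> i" "i + 1 - r = Suc ?s" "i + 1 - Suc r = ?s" using Suc.prems by auto
    have "n - ?s = n - i + r" using r assms(2) by auto
    then have "(n choose Suc ?s) * Suc ?s = (n choose ?s) * (n - i + r)"
      by (metis binomial_absorb_comp binomial_absorption mult.commute)
    then have absorb: "(of_nat (n choose Suc ?s) :: rat) * of_nat (Suc ?s)
        = of_nat (n choose ?s) * of_nat (n - i + r)"
      by (metis of_nat_mult)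
    have "of_nat (n choose (i + 1)) * (\<Prod>j<Suc r. of_nat (i + 1 - j)) =
        (of_nat (n choose (i + 1)) * (\<Prod>j<r. of_nat (i + 1 - j))) * (of_nat (Suc ?s) :: rat)"
      using r by (simp only: prod.lessThan_Suc mult.assoc)
    also have "\<dots> = (of_nat (n choose Suc ?s) * of_nat (Suc ?s)) * (\<Prod>j<r. of_nat (n - i + j))"
      using Suc r by (simp add: mult_ac)
    also have "\<dots> = of_nat (n choose ?s) * (\<Prod>j<Suc r. of_nat (n - i + j))"
      unfolding absorb by (simp only: prod.lessThan_Suc mult_ac)
    finally show ?case using r by simp
  qed
  have "k \<le> i + 1" "i + 1 - k \<le> n" using assms by auto
  moreover from this have "(\<Prod>j<k. of_nat (i + 1 - j) :: rat) \<noteq> 0"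
    by (auto simp del: of_nat_diff)
  ultimately show ?thesis
    using step[of k] unfolding binomial_ratio_def by (simp add: frac_eq_eq mult_ac)
qed

end

theory Submission imports Defs begin

text \<open>With \<open>a\<close> the independence number, every \<open>(a+1)\<close>-subset of the vertices contains an edge \<open>e\<close>,
  so it is the union of \<open>e\<close> and an \<open>(a+1-k)\<close>-subset. Counting such unions gives
  \<open>n choose (a+1) \<le> m * (n choose (a+1-k))\<close>, that is, \<open>f(a) \<le> m\<close>.\<close>

context uniform_hypergraph
begin

lemma finite_edges: "finite E"
  by (rule finite_subset[of _ "Pow V"]) (use finite_vertices edge_subset in auto)

lemma finite_independent_sets: "finite {S. independent_set V E S}"
  by (rule finite_subset[of _ "Pow V"]) (use finite_vertices in \<open>auto simp: independent_set_def\<close>)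

lemma card_le_independence_number:
  assumes "independent_set V E S"
  shows "card S \<le> independence_number V E"
  unfolding independence_number_def using assms finite_independent_sets by (intro Max_ge) auto

text \<open>The independent set assumed here serves only as a witness that the family under
  \<open>Max\<close> is nonempty, so that the maximum is attained by a subset of
  \<open>V\<close>.\<close>

lemma independence_number_le_card:
  assumes "independent_set V E S"
  shows "independence_number V E \<le> card V"
proof -
  have "finite (card ` {S. independent_set V E S})" "card ` {S. independent_set V E S} \<noteq> {}"
    using assms finite_independent_sets by auto
  then have "independence_number V E \<in> card ` {S. independent_set V E S}"
    unfolding independence_number_def by (rule Max_in)
  then show ?thesis
    using finite_vertices by (auto simp: independent_set_def intro: card_mono)
qed

text \<open>An edge has \<open>k\<close> elements and cannot fit into a smaller set. This supplies
  the lower bound \<open>k - 1\<close> on the independence number.\<close>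

lemma independent_set_if_card_less:
  assumes "S \<subseteq> V" "card S < k"
  shows "independent_set V E S"
proof -
  have "\<not> e \<subseteq> S" if "e \<in> E" for e
    using edge_card[OF that] assms card_mono[of S e] finite_subset[OF assms(1) finite_vertices] by auto
  then show ?thesis
    using assms(1) by (simp add: independent_set_def)
qed

lemma choose_le_card_edges_mult:
  assumes "independence_number V E < r"
  shows "card V choose r \<le> card E * (card V choose (r - k))"
proof -
  let ?sub = "\<lambda>j. {T. T \<subseteq> V \<and> card T = j}"
  have fin: "finite (?sub j)" for j
    using finite_vertices by simp
  have "?sub r \<subseteq> (\<Union>e\<in>E. (\<lambda>T. e \<union> T) ` ?sub (r - k))"
  proof
    fix S assume "S \<in> ?sub r"
    then have S: "S \<subseteq> V" "card S = r" by auto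
    then have "\<not> independent_set V E S"
      using assms card_le_independence_number[of S] by auto
    then obtain e where e: "e \<in> E" "e \<subseteq> S"
      using S by (auto simp: independent_set_def)
    moreover have "card (S - e) = r - k"
      using S e edge_card finite_subset[OF _ finite_vertices] by (metis card_Diff_subset edge_subset)
    ultimately show "S \<in> (\<Union>e\<in>E. (\<lambda>T. e \<union> T) ` ?sub (r - k))"
      using S by (intro UN_I[OF e(1)] image_eqI[of _ _ "S - e"]) auto
  qed
  then have "card (?sub r) \<le> card (\<Union>e\<in>E. (\<lambda>T. e \<union> T) ` ?sub (r - k))"
    by (rule card_mono[rotated]) (use finite_edges fin in blast)
  \<comment> \<open>Union bound over the edges. For fixed \<open>e\<close>, different
    \<open>T\<close> may overlap \<open>e\<close> and give the same union, so each image is only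
    bounded by the number of \<open>T\<close>.\<close>
  also have "\<dots> \<le> (\<Sum>e\<in>E. card ((\<lambda>T. e \<union> T) ` ?sub (r - k)))"
    by (rule card_UN_le[OF finite_edges])
  also have "\<dots> \<le> (\<Sum>e\<in>E. card (?sub (r - k)))"
    by (intro sum_mono card_image_le fin)
  finally show ?thesis
    by (simp add: n_subsets[OF finite_vertices])
qed

end

theorem theorem1:
  fixes k :: nat and V :: "'a set" and E :: "'a set set"
  assumes "k \<ge> 1"
    and "uniform_hypergraph k V E"
    and "k - 1 \<le> card V"
  shows "ell k V E \<le> independence_number V E"
proof -
  interpret uniform_hypergraph k V E by fact
  let ?a = "independence_number V E" and ?n = "card V"
  obtain S where S: "S \<subseteq> V" "card S = k - 1"
    using assms(3) by (meson obtain_subset_with_card_n)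
  then have indep: "independent_set V E S"
    using assms(1) by (intro independent_set_if_card_less) auto
  have range: "k - 1 \<le> ?a" "?a \<le> ?n"
    using card_le_independence_number[OF indep] independence_number_le_card[OF indep] S by auto
  \<comment> \<open>From \<open>?a \<le> ?n\<close> and \<open>k \<ge> 1\<close>, the lower index is
    at most \<open>?n\<close>; positivity allows clearing the denominator of
    \<open>f\<close>.\<close>
  have "?n choose (?a + 1 - k) > 0"
    using range(2) assms(1) by simp
  moreover have "(of_nat (?n choose (?a + 1)) :: rat)
      \<le> of_nat (card E) * of_nat (?n choose (?a + 1 - k))"
    using choose_le_card_edges_mult[of "?a + 1"]
    by (simp only: of_nat_le_iff less_add_one flip: of_nat_mult)
  ultimately have "binomial_ratio k ?n ?a \<le> of_nat (card E)"
    unfolding binomial_ratio_def by (subst pos_divide_le_eq) auto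
  \<comment> \<open>Now \<open>?a\<close> lies in the range of \<open>f\<close> and satisfies
    \<open>f(?a) \<le> m\<close>, so it is a candidate in the minimum defining
    \<open>ell\<close>.\<close>
  then show ?thesis
    unfolding ell_def using range by (intro Min_le) auto
qed

end
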